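(* Let the approximate value iteration described in the context be initiated using the approximate value function $\hat V^0$ of a control policy $h^{-1}$ that is admissible in $\Omega$, and be conducted using a continuous function approximator with approximation errors bounded by $|\epsilon^i(x)|\le c\,U(x,0)$ for all $i\in\mathbb N\cup\{-1\}$ and all $x\in\Omega$, for some $c\in[0,1)$. Let $V^0:=V_{h^{-1}}$ denote the exact value function of $h^{-1}$. Let the system be operated using the sequence of control policies $\{\hat h^i\}_{i=0}^\infty$, where each $\hat h^i$ is applied for $M_i$ time steps ($M_i$ a positive integer) before switching to $\hat h^{i+1}$, i.e. $x_{k+1}=f(x_k,\hat h^i(x_k))$ whenever $\sum_{j=0}^{i-1}M_j\le k<\sum_{j=0}^{i}M_j$. Let $c$ be such that $$0\le c<1+4\gamma-\sqrt{16\gamma^2+8\gamma}$$ for some $\gamma\in\mathbb R_+$ that satisfies $V^0(x)\le\gamma U(x,0)$ for all $x\in\Omega$. Moreover, let $\hat{\mathcal B}^i_r:=\{x\in\mathbb R^n:\hat V^i(x)\le r\}$ and $\mathcal B^*_r:=\{x\in\mathbb R^n:V^*(x)\le r\}$ for any $r\in\mathbb R_+$, where $V^*$ is the optimal value function. If $\mathcal B^*_r\subset\Omega$ for a given $r>0$, then the compact set $\hat{\mathcal B}^0_{(1-c)r}$ is an estimation of the region of attraction of the system under the evolving control policy of applying each $\hat h^i$ for $M_i$ time steps.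
   Context: Notation: $\mathbb N=\{0,1,2,\dots\}$; $\mathbb R_+$ is the set of non-negative reals. System and cost. $x_{k+1}=f(x_k,u_k)$, $k\in\mathbb N$, where $f:\mathbb R^n\times\mathbb R^m\to\mathbb R^n$ is continuous and $f(0,0)=0$. The cost function is $J=\sum_{k=0}^\infty U(x_k,u_k)$ with utility $U(x,u)=Q(x)+R(u)$, where $Q:\mathbb R^n\to\mathbb R_+$ and $R:\mathbb R^m\to\mathbb R_+$ are continuous and positive definite. $\Omega\subset\mathbb R^n$ (the region of interest, over which the approximation is performed) is a compact connected set containing the origin. Value functions and admissibility. For a policy $h:\mathbb R^n\to\mathbb R^m$ and an initial state $x_0$ put $x^h_0:=x_0$, $x^h_k:=f(x^h_{k-1},h(x^h_{k-1}))$ for $k\ge1$, and define its value function $V_h(x_0):=\sum_{k=0}^\infty U(x^h_k,h(x^h_k))$. The policy $h$ is admissible in $\Omega$ if $h$ is continuous in $\Omega$, $h(0)=0$, and $V_h$ is continuous in $\Omega$. The optimal control policy $h^*$ is the policy using which the cost $J$ is minimized subject to the dynamics, and the optimal value function is its value function $V^*:=V_{h^*}$. Approximate value iteration. The functions $\hat V^i$, $i\in\mathbb N$, are the real-valued continuous outputs of the function approximator. The initial function $\hat V^0$ is an approximate value function of $h^{-1}$ in the sense that $\hat V^0(0)=0$ and $$\hat V^0(x)=U(x,h^{-1}(x))+\hat V^0\big(f(x,h^{-1}(x))\big)+\epsilon^{-1}(x),\quad\forall x\in\Omega.$$ For each $i\in\mathbb N$, the policy $\hat h^i$ is any selection of minimizers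 $$\hat h^i(x)\in\arg\min_{u\in\mathbb R^m}\big(U(x,u)+\hat V^i(f(x,u))\big),\quad\forall x\in\Omega,$$ and $$\hat V^{i+1}(x)=U(x,\hat h^i(x))+\hat V^i\big(f(x,\hat h^i(x))\big)+\epsilon^i(x),\quad\forall x\in\Omega.$$ The functions $\epsilon^i$, $i\in\mathbb N\cup\{-1\}$, are the approximation errors. Estimation of the region of attraction. A set $\mathcal B\subset\mathbb R^n$ is an estimation of the region of attraction for the controlled system if any state trajectory of the system initiated (at time $k=0$) inside $\mathcal B$ is defined and converges to the origin as $k\to\infty$.
   Formalization: Added assumption: for every i, V̂^i(x) > (1-c)r at all x outside Ω (so the sets B̂^i_{(1-c)r} lie in Ω). The iteration does not constrain V̂^i outside Ω, and the claim fails if V̂^i is small there. *)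

theory Defs
  imports "HOL-Analysis.Analysis"
begin

definition positive_definite :: "(real^'n \<Rightarrow> real) \<Rightarrow> bool" where
  "positive_definite Q \<longleftrightarrow> Q 0 = 0 \<and> (\<forall>x. x \<noteq> 0 \<longrightarrow> Q x > 0)"

definition utility :: "(real^'n \<Rightarrow> real) \<Rightarrow> (real^'m \<Rightarrow> real) \<Rightarrow> real^'n \<Rightarrow> real^'m \<Rightarrow> real" where
  "utility Q R x u = Q x + R u"

primrec policy_traj ::
  "(real^'n \<Rightarrow> real^'m \<Rightarrow> real^'n) \<Rightarrow> (real^'n \<Rightarrow> real^'m) \<Rightarrow> real^'n \<Rightarrow> nat \<Rightarrow> real^'n" where
  "policy_traj f h x0 0 = x0"
| "policy_traj f h x0 (Suc k) = f (policy_traj f h x0 k) (h (policy_traj f h x0 k))"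

text \<open>
  The cost of a state and control sequence may diverge, so costs and value functions take values
  in the extended non-negative reals. The utility is non-negative wherever this is used.
\<close>

definition total_cost ::
  "(real^'n \<Rightarrow> real^'m \<Rightarrow> real) \<Rightarrow> (nat \<Rightarrow> real^'n) \<Rightarrow> (nat \<Rightarrow> real^'m) \<Rightarrow> ennreal" where
  "total_cost U x u = (\<Sum>k. ennreal (U (x k) (u k)))"

definition value_function ::
  "(real^'n \<Rightarrow> real^'m \<Rightarrow> real^'n) \<Rightarrow> (real^'n \<Rightarrow> real^'m \<Rightarrow> real) \<Rightarrow> (real^'n \<Rightarrow> real^'m)
    \<Rightarrow> real^'n \<Rightarrow> ennreal" where
  "value_function f U h x0 = total_cost U (policy_traj f h x0) (\<lambda>k. h (policy_traj f h x0 k))"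

text \<open>Continuity of a value function is meant for a real-valued function, hence the finiteness.\<close>

definition admissible ::
  "(real^'n \<Rightarrow> real^'m \<Rightarrow> real^'n) \<Rightarrow> (real^'n \<Rightarrow> real^'m \<Rightarrow> real) \<Rightarrow> (real^'n) set
    \<Rightarrow> (real^'n \<Rightarrow> real^'m) \<Rightarrow> bool" where
  "admissible f U \<Omega> h \<longleftrightarrow>
     continuous_on \<Omega> h \<and> h 0 = 0 \<and>
     (\<forall>x\<in>\<Omega>. value_function f U h x < \<infinity>) \<and> continuous_on \<Omega> (value_function f U h)"

definition optimal_policy ::
  "(real^'n \<Rightarrow> real^'m \<Rightarrow> real^'n) \<Rightarrow> (real^'n \<Rightarrow> real^'m \<Rightarrow> real) \<Rightarrow> (real^'n \<Rightarrow> real^'m) \<Rightarrow> bool" where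
  "optimal_policy f U h \<longleftrightarrow>
     (\<forall>x u. (\<forall>k. x (Suc k) = f (x k) (u k)) \<longrightarrow> value_function f U h (x 0) \<le> total_cost U x u)"

text \<open>
  The errors are indexed by integers, so that \<open>\<epsilon> (-1)\<close> belongs to the evaluation of the initial
  policy \<open>g\<close>. Values of \<open>V i\<close> and \<open>h i\<close> outside \<open>\<Omega>\<close> are not determined by these relations.
\<close>

definition approximate_value_iteration ::
  "(real^'n \<Rightarrow> real^'m \<Rightarrow> real^'n) \<Rightarrow> (real^'n \<Rightarrow> real^'m \<Rightarrow> real) \<Rightarrow> (real^'n) set
    \<Rightarrow> (real^'n \<Rightarrow> real^'m) \<Rightarrow> (nat \<Rightarrow> real^'n \<Rightarrow> real) \<Rightarrow> (nat \<Rightarrow> real^'n \<Rightarrow> real^'m)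
    \<Rightarrow> (int \<Rightarrow> real^'n \<Rightarrow> real) \<Rightarrow> bool" where
  "approximate_value_iteration f U \<Omega> g V h \<epsilon> \<longleftrightarrow>
     (\<forall>i. continuous_on \<Omega> (V i)) \<and>
     V 0 0 = 0 \<and>
     (\<forall>x\<in>\<Omega>. V 0 x = U x (g x) + V 0 (f x (g x)) + \<epsilon> (-1) x) \<and>
     (\<forall>i. \<forall>x\<in>\<Omega>. is_arg_min (\<lambda>u. U x u + V i (f x u)) (\<lambda>_. True) (h i x)) \<and>
     (\<forall>i. \<forall>x\<in>\<Omega>. V (Suc i) x = U x (h i x) + V i (f x (h i x)) + \<epsilon> (int i) x)"

text \<open>
  Trajectories under the evolving policy. The policies are only specified on \<open>\<Omega>\<close>, so a trajectory
  is defined for all times only if it stays in \<open>\<Omega>\<close>.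
\<close>

definition evolving_traj ::
  "(real^'n \<Rightarrow> real^'m \<Rightarrow> real^'n) \<Rightarrow> (real^'n) set \<Rightarrow> (nat \<Rightarrow> real^'n \<Rightarrow> real^'m) \<Rightarrow> (nat \<Rightarrow> nat)
    \<Rightarrow> (nat \<Rightarrow> real^'n) \<Rightarrow> bool" where
  "evolving_traj f \<Omega> h M x \<longleftrightarrow>
     (\<forall>i k. (\<Sum>j<i. M j) \<le> k \<and> k < (\<Sum>j\<le>i. M j) \<longrightarrow>
        x k \<in> \<Omega> \<and> x (Suc k) = f (x k) (h i (x k)))"

text \<open>
  The argument \<open>T\<close> is the set of trajectories of the controlled system. The existence part says
  that the trajectory from each initial state in \<open>B\<close> is defined for all times.
\<close>

definition roa_estimation :: "(nat \<Rightarrow> real^'n) set \<Rightarrow> (real^'n) set \<Rightarrow> bool" where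
  "roa_estimation T B \<longleftrightarrow>
     (\<forall>x0\<in>B. (\<exists>x\<in>T. x 0 = x0) \<and> (\<forall>x\<in>T. x 0 = x0 \<longrightarrow> x \<longlonglongrightarrow> 0))"

end

theory Submission
  imports Defs
begin

text \<open>
  Put \<open>s = (1 - c) * r\<close>. On the sublevel set of \<open>V i\<close> at \<open>s\<close>, comparing the minimizer with the
  previous policy gives \<open>V (i + 1) \<le> (1 + 2 * c / (1 - c)) * V i\<close>, and \<open>V i \<le> (1 + c) * \<gamma> * Q\<close>: either
  the trajectory of the initial policy stays in \<open>\<Omega>\<close> and the bound follows by telescoping, or it
  leaves \<open>\<Omega>\<close>, hence leaves the sublevel set of the optimal value function at \<open>r\<close>, which forces
  \<open>\<gamma> * Q > r\<close>. So \<open>V (i + 1) - V i \<le> \<kappa> * Q\<close>, and the condition on \<open>c\<close>, equivalent to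
  \<open>8 * \<gamma> * c < (1 - c)\<^sup>2\<close> with \<open>c\<close> below the smaller root, makes \<open>2 * \<kappa> < 1 - c\<close>. One \<open>\<kappa>\<close> pays for the growth of
  the value function from one iterate to the next along \<open>h i\<close>, the other for a switch of the policy.
  Hence \<open>V i (x (k + 1))\<close>, where \<open>i\<close> is the index of the policy used at time \<open>k\<close>, is a Lyapunov
  function.
\<close>

section \<open>Convergence to the origin and costs along trajectories\<close>

text \<open>Outside any ball about the origin, \<open>Q\<close> has a positive minimum on the
  compact set \<open>K\<close>, so small values of \<open>Q\<close> force states close to the
  origin.\<close>

lemma tendsto_zero_positive_definite:
  fixes Q :: "real^'n \<Rightarrow> real" and x :: "nat \<Rightarrow> real^'n"
  assumes "compact K" "continuous_on K Q" "positive_definite Q"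
    and "\<And>k. x k \<in> K" "(\<lambda>k. Q (x k)) \<longlonglongrightarrow> 0"
  shows "x \<longlonglongrightarrow> 0"
proof (rule tendstoI)
  fix e :: real assume "e > 0"
  show "\<forall>\<^sub>F k in sequentially. dist (x k) 0 < e"
  proof (cases "K - ball 0 e = {}")
    case True
    then have "dist (x k) 0 < e" for k
      using assms(4)[of k] by (auto simp: dist_commute)
    then show ?thesis by simp
  next
    case False
    have "compact (K - ball 0 e)" "continuous_on (K - ball 0 e) Q"
      using assms(1,2) by (auto intro: compact_diff continuous_on_subset)
    from continuous_attains_inf[OF this(1) False this(2)]
    obtain z where z: "z \<in> K - ball 0 e" "\<forall>y\<in>K - ball 0 e. Q z \<le> Q y" by blast
    have "Q z > 0" using z(1) \<open>e > 0\<close> assms(3) by (cases "z = 0") (auto simp: positive_definite_def)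
    then have "\<forall>\<^sub>F k in sequentially. Q (x k) < Q z" by (rule order_tendstoD(2)[OF assms(5)])
    then show ?thesis
    proof (rule eventually_mono)
      fix k assume "Q (x k) < Q z"
      then have "x k \<notin> K - ball 0 e" using z(2) by force
      then show "dist (x k) 0 < e" using assms(4)[of k] by (simp add: dist_commute)
    qed
  qed
qed

lemma policy_traj_Suc_shift:
  "policy_traj f h x (Suc k) = policy_traj f h (f x (h x)) k"
  by (induction k) auto

lemma policy_traj_add:
  "policy_traj f h x (j + k) = policy_traj f h (policy_traj f h x j) k"
  by (induction k) auto

lemma value_function_policy_traj_le:
  "value_function f U h (policy_traj f h x j) \<le> value_function f U h x"
proof -
  let ?a = "\<lambda>k. ennreal (U (policy_traj f h x k) (h (policy_traj f h x k)))"
  have "(\<Sum>k. ?a (k + j)) \<le> (\<Sum>k. ?a (k + j)) + sum ?a {..<j}" by simp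
  also have "\<dots> = (\<Sum>k. ?a k)" by (rule suminf_offset[symmetric]) simp
  finally show ?thesis
    by (simp add: value_function_def total_cost_def policy_traj_add[symmetric] add.commute)
qed

lemma partial_cost_le_value_function:
  assumes "\<And>x u. 0 \<le> U x u" "value_function f U h x \<le> ennreal b" "0 \<le> b"
  shows "(\<Sum>k<N. U (policy_traj f h x k) (h (policy_traj f h x k))) \<le> b"
proof -
  have "ennreal (\<Sum>k<N. U (policy_traj f h x k) (h (policy_traj f h x k))) \<le> value_function f U h x"
    unfolding value_function_def total_cost_def
    by (subst sum_ennreal[symmetric]) (auto intro!: sum_le_suminf assms)
  also note assms(2)
  finally show ?thesis using assms(3) by simp
qed

lemma optimal_policy_le:
  assumes "optimal_policy f U hstar"
  shows "value_function f U hstar x \<le> value_function f U h x"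
  using assms[unfolded optimal_policy_def,
      rule_format, of "policy_traj f h x" "\<lambda>k. h (policy_traj f h x k)"]
  by (simp add: value_function_def)

section \<open>The policy active at a given time\<close>

definition policy_index :: "(nat \<Rightarrow> nat) \<Rightarrow> nat \<Rightarrow> nat" where
  "policy_index M k = (LEAST i. k < (\<Sum>j\<le>i. M j))"

lemma policy_index_bounds:
  assumes "\<And>i. M i > (0::nat)"
  shows "(\<Sum>j<policy_index M k. M j) \<le> k" "k < (\<Sum>j\<le>policy_index M k. M j)"
proof -
  \<comment> \<open>Every duration is at least 1, so \<open>k\<close> itself satisfies the condition
    under \<open>LEAST\<close>.\<close>
  have "i < (\<Sum>j\<le>i. M j)" for i
  proof (induction i)
    case (Suc i)
    then show ?case using assms[of "Suc i"] by simp
  qed (use assms in simp)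
  then show *: "k < (\<Sum>j\<le>policy_index M k. M j)"
    unfolding policy_index_def by (rule LeastI)
  show "(\<Sum>j<policy_index M k. M j) \<le> k"
  proof (cases "policy_index M k")
    case (Suc i)
    then have "\<not> k < (\<Sum>j\<le>i. M j)"
      unfolding policy_index_def by (intro not_less_Least) simp
    then show ?thesis using Suc by (simp add: lessThan_Suc_atMost)
  qed simp
qed

lemma policy_index_eqI:
  assumes "(\<Sum>j<i. M j) \<le> k" "k < (\<Sum>j\<le>i. M j)"
  shows "policy_index M k = i"
  unfolding policy_index_def
proof (rule Least_equality)
  fix l assume l: "k < (\<Sum>j\<le>l. M j)"
  show "i \<le> l"
  proof (rule ccontr)
    assume "\<not> i \<le> l"
    then have "(\<Sum>j\<le>l. M j) \<le> (\<Sum>j<i. M j)" by (intro sum_mono2) auto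
    then show False using l assms(1) by simp
  qed
qed (fact assms(2))

lemma policy_index_0:
  assumes "\<And>i. M i > (0::nat)"
  shows "policy_index M 0 = 0"
  using assms by (intro policy_index_eqI) auto

text \<open>Each policy lasts at least one step, so no index is skipped; the Lyapunov estimate then
  has two cases only.\<close>

lemma policy_index_Suc:
  assumes "\<And>i. M i > (0::nat)"
  shows "policy_index M (Suc k) = policy_index M k \<or> policy_index M (Suc k) = Suc (policy_index M k)"
proof (cases "Suc k < (\<Sum>j\<le>policy_index M k. M j)")
  case True
  then show ?thesis
    using policy_index_bounds(1)[where M = M and k = k, OF assms] by (intro disjI1 policy_index_eqI) auto
next
  case False
  then show ?thesis
    using policy_index_bounds(2)[where M = M and k = k, OF assms] assms[of "Suc (policy_index M k)"]
    by (intro disjI2 policy_index_eqI) (auto simp: lessThan_Suc_atMost)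
qed

lemma evolving_traj_iff:
  assumes "\<And>i. M i > (0::nat)"
  shows "evolving_traj f \<Omega> h M x \<longleftrightarrow>
    (\<forall>k. x k \<in> \<Omega> \<and> x (Suc k) = f (x k) (h (policy_index M k) (x k)))"
  unfolding evolving_traj_def
  using policy_index_bounds[where M = M, OF assms] policy_index_eqI by metis

section \<open>Real-valued setting and non-negativity of the iterates\<close>

text \<open>Here \<open>s\<close> plays the role of \<open>(1 - c) * r\<close>. The last two
  assumptions distill what is used of the value functions of the initial and the optimal policy, so
  that extended reals no longer appear.\<close>

locale approximate_vi =
  fixes f :: "real^'n \<Rightarrow> real^'m \<Rightarrow> real^'n"
    and Q :: "real^'n \<Rightarrow> real" and R :: "real^'m \<Rightarrow> real"
    and \<Omega> :: "(real^'n) set"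
    and g :: "real^'n \<Rightarrow> real^'m"
    and V :: "nat \<Rightarrow> real^'n \<Rightarrow> real"
    and h :: "nat \<Rightarrow> real^'n \<Rightarrow> real^'m"
    and \<epsilon> :: "int \<Rightarrow> real^'n \<Rightarrow> real"
    and c \<gamma> s :: real
  assumes compact_\<Omega>: "compact \<Omega>" and zero_in_\<Omega>: "0 \<in> \<Omega>"
    and Q_pos_def: "positive_definite Q" and Q_cont: "continuous_on \<Omega> Q"
    and R_nonneg: "\<And>u. 0 \<le> R u"
    and iteration: "approximate_value_iteration f (utility Q R) \<Omega> g V h \<epsilon>"
    and error: "\<And>i x. i \<ge> -1 \<Longrightarrow> x \<in> \<Omega> \<Longrightarrow> \<bar>\<epsilon> i x\<bar> \<le> c * Q x"
    and c_nonneg: "0 \<le> c" and c_less_1: "c < 1" and \<gamma>_nonneg: "0 \<le> \<gamma>"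
    and c_small: "8 * \<gamma> * c < (1 - c)\<^sup>2"
    and s_pos: "0 < s"
    and off_\<Omega>: "\<And>i x. x \<notin> \<Omega> \<Longrightarrow> s < V i x"
    and cost_bound: "\<And>x N. x \<in> \<Omega> \<Longrightarrow>
      (\<Sum>k<N. utility Q R (policy_traj f g x k) (g (policy_traj f g x k))) \<le> \<gamma> * Q x"
    and exit_bound: "\<And>x k. x \<in> \<Omega> \<Longrightarrow> policy_traj f g x k \<notin> \<Omega> \<Longrightarrow> s \<le> (1 - c) * (\<gamma> * Q x)"
begin

lemma Q_nonneg: "0 \<le> Q x"
  using Q_pos_def by (cases "x = 0") (auto simp: positive_definite_def less_imp_le)

lemma V_cont: "continuous_on \<Omega> (V i)"
  and V_0_0: "V 0 0 = 0"
  using iteration by (auto simp: approximate_value_iteration_def)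

lemma sublevel_subset: "V i x \<le> s \<Longrightarrow> x \<in> \<Omega>"
  using off_\<Omega>[of x i] by force

lemma V_0_ge: "x \<in> \<Omega> \<Longrightarrow> (1 - c) * Q x + R (g x) + V 0 (f x (g x)) \<le> V 0 x"
  and V_0_le: "x \<in> \<Omega> \<Longrightarrow> V 0 x \<le> (1 + c) * Q x + R (g x) + V 0 (f x (g x))"
  using iteration error[of "-1" x]
  by (auto simp: approximate_value_iteration_def utility_def algebra_simps)

lemma V_Suc_ge: "x \<in> \<Omega> \<Longrightarrow> (1 - c) * Q x + R (h i x) + V i (f x (h i x)) \<le> V (Suc i) x"
  using iteration error[of "int i" x]
  by (auto simp: approximate_value_iteration_def utility_def algebra_simps)

text \<open>Minimality of \<open>h i x\<close> permits any competitor \<open>u\<close>; below it is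
  the control of the initial policy or of the preceding minimizer.\<close>

lemma V_Suc_le:
  assumes "x \<in> \<Omega>"
  shows "V (Suc i) x \<le> (1 + c) * Q x + R u + V i (f x u)"
proof -
  have "is_arg_min (\<lambda>u. utility Q R x u + V i (f x u)) (\<lambda>_. True) (h i x)"
    and "V (Suc i) x = utility Q R x (h i x) + V i (f x (h i x)) + \<epsilon> (int i) x"
    using iteration assms by (auto simp: approximate_value_iteration_def)
  then show ?thesis
    using error[of "int i" x] assms
    by (auto simp: is_arg_min_linorder utility_def algebra_simps
        dest!: spec[of "\<lambda>y. _ y \<le> _ y" u] spec[of _ u])
qed

text \<open>At a negative minimum over \<Omega>, which is not at the origin, one step of
  \<open>g\<close> would lower the value further, and a negative value lies below \<open>s\<close>,
  hence is attained only inside \<Omega>.\<close>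

lemma V_0_nonneg: "0 \<le> V 0 x"
proof -
  obtain z where z: "z \<in> \<Omega>" "\<forall>y\<in>\<Omega>. V 0 z \<le> V 0 y"
    using continuous_attains_inf[OF compact_\<Omega> _ V_cont] zero_in_\<Omega> by blast
  have "0 \<le> V 0 z"
  proof (rule ccontr)
    assume neg: "\<not> 0 \<le> V 0 z"
    then have "z \<noteq> 0" using V_0_0 by auto
    then have "0 < (1 - c) * Q z"
      using Q_pos_def c_less_1 by (simp add: positive_definite_def)
    then have less: "V 0 (f z (g z)) < V 0 z"
      using V_0_ge[OF z(1)] R_nonneg[of "g z"] by simp
    then have "f z (g z) \<in> \<Omega>"
      using neg s_pos by (intro sublevel_subset[of 0]) simp
    then show False using z(2) less by force
  qed
  then show ?thesis using z(2) off_\<Omega>[of x 0] s_pos by force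
qed

lemma V_nonneg: "0 \<le> V i x"
proof (induction i arbitrary: x)
  case (Suc i)
  show ?case
  proof (cases "x \<in> \<Omega>")
    case True
    have "0 \<le> (1 - c) * Q x" using Q_nonneg[of x] c_less_1 by simp
    then show ?thesis using V_Suc_ge[OF True, of i] R_nonneg[of "h i x"] Suc[of "f x (h i x)"] by simp
  qed (use off_\<Omega>[of x "Suc i"] s_pos in simp)
qed (rule V_0_nonneg)

section \<open>Relative growth from one iterate to the next\<close>

definition a :: real where "a = 2 * c / (1 - c)"

definition \<kappa> :: real where "\<kappa> = a * ((1 + c) * \<gamma>)"

lemma a_nonneg: "0 \<le> a"
  using c_nonneg c_less_1 by (simp add: a_def)

text \<open>\<open>a\<close> is chosen for this identity: it turns the gap
  \<open>2 * c * Q x\<close> between the two error bounds into a multiple of the stage cost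
  \<open>(1 - c) * Q x\<close> contained in the iterate. Equivalently,
  \<open>(1 + a) * (1 - c) = 1 + c\<close>.\<close>

lemma a_mult: "a * ((1 - c) * y) = 2 * c * y"
  using c_less_1 by (simp add: a_def)

lemma \<kappa>_nonneg: "0 \<le> \<kappa>"
  using a_nonneg c_nonneg \<gamma>_nonneg by (simp add: \<kappa>_def)

lemma \<kappa>_less: "2 * \<kappa> < 1 - c"
proof -
  \<comment> \<open>Bounding \<open>1 + c\<close> by 2 accounts for the factor 8 in
    \<open>c_small\<close>.\<close>
  have "(c * \<gamma>) * (1 + c) \<le> (c * \<gamma>) * 2"
    using c_nonneg c_less_1 \<gamma>_nonneg by (intro mult_left_mono) auto
  then have "4 * c * (1 + c) * \<gamma> < (1 - c) * (1 - c)"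
    using c_small by (simp add: power2_eq_square algebra_simps)
  moreover have "2 * \<kappa> = 4 * c * (1 + c) * \<gamma> / (1 - c)"
    by (simp add: \<kappa>_def a_def)
  ultimately show ?thesis using c_less_1 by (simp add: divide_less_eq)
qed

text \<open>Reusing \<open>h i x\<close> as competitor for the next iterate costs at most
  \<open>2 * c * Q x\<close> plus the growth at the image. The hypothesis concerns the image only,
  so the lemma also serves where \<open>V (Suc i) x\<close> exceeds \<open>s\<close>.\<close>

lemma V_Suc_sub_le_from_image:
  assumes "x \<in> \<Omega>" and "V (Suc i) (f x (h i x)) - V i (f x (h i x)) \<le> a * V i (f x (h i x))"
  shows "V (Suc (Suc i)) x - V (Suc i) x \<le> a * V (Suc i) x"
proof -
  let ?y = "f x (h i x)"
  have "V (Suc (Suc i)) x - V (Suc i) x \<le> 2 * c * Q x + (V (Suc i) ?y - V i ?y)"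
    using V_Suc_le[OF assms(1), of "Suc i" "h i x"] V_Suc_ge[OF assms(1), of i]
    by (simp add: algebra_simps)
  also have "\<dots> \<le> a * ((1 - c) * Q x + V i ?y)"
    using assms(2) a_mult[of "Q x"] by (simp only: distrib_left)
  also have "\<dots> \<le> a * V (Suc i) x"
    using V_Suc_ge[OF assms(1), of i] R_nonneg[of "h i x"] a_nonneg by (intro mult_left_mono) auto
  finally show ?thesis .
qed

lemma V_Suc_sub_le:
  assumes "V i x \<le> s"
  shows "V (Suc i) x - V i x \<le> a * V i x"
  using assms
proof (induction i arbitrary: x)
  case 0
  then have x: "x \<in> \<Omega>" by (rule sublevel_subset)
  have "V (Suc 0) x - V 0 x \<le> a * ((1 - c) * Q x)"
    unfolding a_mult using V_Suc_le[OF x, of 0 "g x"] V_0_ge[OF x] by (simp add: algebra_simps)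
  also have "\<dots> \<le> a * V 0 x"
    using V_0_ge[OF x] R_nonneg[of "g x"] V_nonneg[of 0 "f x (g x)"] a_nonneg
    by (intro mult_left_mono) auto
  finally show ?case .
next
  case (Suc i)
  then have x: "x \<in> \<Omega>" by (intro sublevel_subset)
  have "0 \<le> (1 - c) * Q x" using Q_nonneg[of x] c_less_1 by simp
  \<comment> \<open>The image drops one index and stays below the same level, which feeds the
    induction.\<close>
  then have "V i (f x (h i x)) \<le> s"
    using V_Suc_ge[OF x, of i] R_nonneg[of "h i x"] Suc.prems by simp
  then show ?case by (intro V_Suc_sub_le_from_image x Suc.IH)
qed

section \<open>Bounding the iterates by the cost of the initial policy\<close>

text \<open>The initial policy is the competitor in all \<open>i\<close> iteration steps; then the
  equation for \<open>V 0\<close> is unrolled \<open>N\<close> more times. \<open>N\<close> stays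
  free so that the remainder can be sent to zero.\<close>

lemma V_le_cost:
  assumes "\<And>k. policy_traj f g x k \<in> \<Omega>"
  shows "V i x \<le> (1 + c) * (\<Sum>k<i + N. utility Q R (policy_traj f g x k) (g (policy_traj f g x k)))
    + V 0 (policy_traj f g x (i + N))"
proof -
  let ?u = "\<lambda>x k. utility Q R (policy_traj f g x k) (g (policy_traj f g x k))"
  have step: "(1 + c) * Q x + R (g x) \<le> (1 + c) * utility Q R x (g x)" for x
    using mult_nonneg_nonneg[OF c_nonneg R_nonneg[of "g x"]] by (simp add: utility_def algebra_simps)
  show ?thesis
    using assms
  proof (induction i arbitrary: x)
    case 0
    show ?case
    proof (induction N)
      case (Suc N)
      then show ?case
        using V_0_le[OF 0[of N]] step[of "policy_traj f g x N"] by (simp add: algebra_simps)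
    qed simp
  next
    case (Suc i)
    have x: "x \<in> \<Omega>" using Suc.prems[of 0] by simp
    have sum_shift: "(\<Sum>k<Suc (i + N). ?u x k) = utility Q R x (g x) + (\<Sum>k<i + N. ?u (f x (g x)) k)"
      by (simp add: sum.lessThan_Suc_shift policy_traj_Suc_shift del: policy_traj.simps(2) sum.lessThan_Suc)
    have "V i (f x (g x)) \<le> (1 + c) * (\<Sum>k<i + N. ?u (f x (g x)) k)
        + V 0 (policy_traj f g (f x (g x)) (i + N))"
      using Suc.prems[of "Suc _"] by (intro Suc.IH) (simp only: policy_traj_Suc_shift)
    then show ?case
      using V_Suc_le[OF x, of i "g x"] step[of x]
      unfolding add_Suc sum_shift policy_traj_Suc_shift by (simp add: algebra_simps)
  qed
qed

lemma V_le_if_traj_in: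
  assumes "\<And>k. policy_traj f g x k \<in> \<Omega>"
  shows "V i x \<le> (1 + c) * (\<gamma> * Q x)"
proof -
  let ?y = "policy_traj f g x"
  have x: "x \<in> \<Omega>" using assms[of 0] by simp
  have u_nonneg: "0 \<le> utility Q R y u" for y u
    using Q_nonneg R_nonneg by (simp add: utility_def)
  have "summable (\<lambda>k. utility Q R (?y k) (g (?y k)))"
    by (rule summableI_nonneg_bounded[OF _ cost_bound[OF x]]) (rule u_nonneg)
  then have "summable (\<lambda>k. Q (?y k))"
    by (rule summable_comparison_test'[where N = 0]) (simp add: Q_nonneg R_nonneg utility_def)
  then have "?y \<longlonglongrightarrow> 0"
    by (intro tendsto_zero_positive_definite[OF compact_\<Omega> Q_cont Q_pos_def] assms summable_LIMSEQ_zero)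
  then have "(\<lambda>k. V 0 (?y k)) \<longlonglongrightarrow> 0"
    using continuous_on_tendsto_compose[OF V_cont[of 0] _ zero_in_\<Omega>] assms V_0_0 by force
  then have "(\<lambda>N. V 0 (?y (N + i))) \<longlonglongrightarrow> 0" by (rule LIMSEQ_ignore_initial_segment)
  then have lim: "(\<lambda>N. (1 + c) * (\<gamma> * Q x) + V 0 (?y (i + N))) \<longlonglongrightarrow> (1 + c) * (\<gamma> * Q x) + 0"
    by (intro tendsto_intros) (simp add: add.commute)
  have "V i x \<le> (1 + c) * (\<gamma> * Q x) + V 0 (?y (i + N))" for N
    using V_le_cost[OF assms, where i = i and N = N]
      mult_left_mono[OF cost_bound[OF x, of "i + N"], of "1 + c"] c_nonneg by linarith
  then have "V i x \<le> (1 + c) * (\<gamma> * Q x) + 0"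
    by (intro LIMSEQ_le_const[OF lim]) auto
  then show ?thesis by simp
qed

lemma V_le:
  assumes "V i x \<le> s"
  shows "V i x \<le> (1 + c) * (\<gamma> * Q x)" "V (Suc i) x \<le> (1 + c) * (\<gamma> * Q x)"
proof -
  have x: "x \<in> \<Omega>" by (rule sublevel_subset) fact
  have "V i x \<le> (1 + c) * (\<gamma> * Q x) \<and> V (Suc i) x \<le> (1 + c) * (\<gamma> * Q x)"
  proof (cases "\<forall>k. policy_traj f g x k \<in> \<Omega>")
    case True
    then show ?thesis using V_le_if_traj_in by blast
  next
    case False
    then have le: "V i x \<le> (1 - c) * (\<gamma> * Q x)"
      using exit_bound[OF x] assms by force
    have "0 \<le> c * (\<gamma> * Q x)" using c_nonneg \<gamma>_nonneg Q_nonneg[of x] by simp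
    then have "V i x \<le> (1 + c) * (\<gamma> * Q x)" using le by (simp add: algebra_simps)
    moreover have "V (Suc i) x \<le> (1 + c) * (\<gamma> * Q x)"
    proof -
      \<comment> \<open>\<open>V (Suc i) x\<close> need not lie below \<open>s\<close>, so
        \<open>exit_bound\<close> does not apply to it directly; the factor \<open>1 - c\<close> in
        that bound compensates the growth \<open>1 + a\<close>.\<close>
      have "V (Suc i) x \<le> (1 + a) * V i x"
        using V_Suc_sub_le[OF assms] by (simp add: algebra_simps)
      also have "\<dots> \<le> (1 + a) * ((1 - c) * (\<gamma> * Q x))"
        using le a_nonneg by (intro mult_left_mono) auto
      also have "\<dots> = (1 + c) * (\<gamma> * Q x)"
        using a_mult[of "\<gamma> * Q x"] by (simp only: distrib_right) (simp add: algebra_simps)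
      finally show ?thesis .
    qed
    ultimately show ?thesis ..
  qed
  then show "V i x \<le> (1 + c) * (\<gamma> * Q x)" "V (Suc i) x \<le> (1 + c) * (\<gamma> * Q x)" by auto
qed

section \<open>Decrease along the evolving policy\<close>

lemma V_Suc_le_\<kappa>:
  assumes "V i x \<le> s"
  shows "V (Suc i) x \<le> V i x + \<kappa> * Q x"
  using V_Suc_sub_le[OF assms] mult_left_mono[OF V_le(1)[OF assms] a_nonneg]
  by (simp add: \<kappa>_def mult.assoc)

lemma V_image_le:
  assumes "V i x \<le> s"
  shows "V i (f x (h i x)) \<le> V i x - (1 - c - \<kappa>) * Q x"
  using V_Suc_ge[OF sublevel_subset[OF assms], of i] V_Suc_le_\<kappa>[OF assms] R_nonneg[of "h i x"]
  by (simp add: algebra_simps)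

text \<open>\<open>V (Suc i) x\<close> may exceed \<open>s\<close>, so the growth bound is applied
  at the image under \<open>h i\<close>, which is below \<open>s\<close>, and carried back to
  \<open>x\<close>.\<close>

lemma V_image_le_switch:
  assumes "V i x \<le> s"
  shows "V (Suc i) (f x (h (Suc i) x)) \<le> V i x - (1 - c - 2 * \<kappa>) * Q x"
proof -
  have x: "x \<in> \<Omega>" by (rule sublevel_subset) fact
  have "0 \<le> (1 - c - \<kappa>) * Q x" using \<kappa>_less \<kappa>_nonneg Q_nonneg[of x] by simp
  then have "V i (f x (h i x)) \<le> s" using V_image_le[OF assms] assms by simp
  then have "V (Suc (Suc i)) x - V (Suc i) x \<le> a * V (Suc i) x"
    by (intro V_Suc_sub_le_from_image x V_Suc_sub_le)
  also have "\<dots> \<le> \<kappa> * Q x"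
    using mult_left_mono[OF V_le(2)[OF assms] a_nonneg] by (simp add: \<kappa>_def mult.assoc)
  finally show ?thesis
    using V_Suc_ge[OF x, of "Suc i"] V_Suc_le_\<kappa>[OF assms] R_nonneg[of "h (Suc i) x"]
    by (simp add: algebra_simps)
qed

text \<open>The index in \<open>W k\<close> belongs to the policy that led to \<open>x k\<close>, so
  a switch is charged to the following step. The recursion is assumed only inside \<Omega>; the
  bound \<open>W k \<le> s\<close> keeps the states there.\<close>

lemma evolving_in_\<Omega>_and_tendsto:
  assumes M: "\<And>i. M i > 0" and start: "V 0 (x 0) \<le> s"
    and step: "\<And>k. x k \<in> \<Omega> \<Longrightarrow> x (Suc k) = f (x k) (h (policy_index M k) (x k))"
  shows "x k \<in> \<Omega>" and "x \<longlonglongrightarrow> 0"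
proof -
  \<comment> \<open>Truncated subtraction makes \<open>W 0 = V 0 (x 0)\<close>.\<close>
  define W where "W k = V (policy_index M (k - 1)) (x k)" for k
  define \<delta> where "\<delta> = 1 - c - 2 * \<kappa>"
  have \<delta>: "0 < \<delta>" using \<kappa>_less by (simp add: \<delta>_def)
  have W_Suc: "W (Suc k) \<le> W k - \<delta> * Q (x k)" if "W k \<le> s" for k
  proof -
    let ?i = "policy_index M (k - 1)"
    have s: "V ?i (x k) \<le> s" using that by (simp add: W_def)
    have eq: "W (Suc k) = V (policy_index M k) (f (x k) (h (policy_index M k) (x k)))"
      using step[OF sublevel_subset[OF s]] by (simp add: W_def)
    have "policy_index M k = ?i \<or> policy_index M k = Suc ?i"
      using policy_index_Suc[where M = M, OF M, of "k - 1"] by (cases k) auto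
    then show ?thesis
    proof
      assume i: "policy_index M k = ?i"
      have "0 \<le> \<kappa> * Q (x k)" using \<kappa>_nonneg Q_nonneg by simp
      then show ?thesis
        using V_image_le[OF s] unfolding eq i by (simp add: W_def \<delta>_def algebra_simps)
    next
      assume i: "policy_index M k = Suc ?i"
      show ?thesis
        using V_image_le_switch[OF s] unfolding eq i by (simp add: W_def \<delta>_def)
    qed
  qed
  have \<delta>_Q: "0 \<le> \<delta> * Q y" for y using \<delta> Q_nonneg by simp
  have W_le: "W k \<le> s" for k
  proof (induction k)
    case 0
    then show ?case using start policy_index_0[where M = M, OF M] by (simp add: W_def)
  next
    case (Suc k)
    then show ?case using W_Suc[OF Suc] \<delta>_Q[of "x k"] by simp
  qed
  then show in_\<Omega>: "x k \<in> \<Omega>" for k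
    unfolding W_def by (rule sublevel_subset)
  have W_telescope: "(\<Sum>k<N. \<delta> * Q (x k)) \<le> W 0 - W N" for N
  proof (induction N)
    case (Suc N)
    then show ?case using W_Suc[OF W_le, of N] by simp
  qed simp
  have "(\<Sum>k<N. \<delta> * Q (x k)) \<le> W 0" for N
    using W_telescope[of N] V_nonneg[of "policy_index M (N - 1)" "x N"] by (simp add: W_def)
  then have "summable (\<lambda>k. \<delta> * Q (x k))" by (intro summableI_nonneg_bounded \<delta>_Q)
  then have "(\<lambda>k. Q (x k)) \<longlonglongrightarrow> 0"
    using \<delta> by (intro summable_LIMSEQ_zero) simp
  then show "x \<longlonglongrightarrow> 0"
    by (intro tendsto_zero_positive_definite[OF compact_\<Omega> Q_cont Q_pos_def] in_\<Omega>)
qed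

lemma compact_sublevel: "compact {x. V i x \<le> s}"
proof -
  have "closed {x \<in> \<Omega>. V i x \<le> s}"
    using continuous_on_closed_Collect_le[OF V_cont continuous_on_const compact_imp_closed[OF compact_\<Omega>]] .
  moreover have "{x. V i x \<le> s} = \<Omega> \<inter> {x \<in> \<Omega>. V i x \<le> s}"
    using sublevel_subset by auto
  ultimately show ?thesis using compact_Int_closed[OF compact_\<Omega>] by simp
qed

lemma roa_estimation_sublevel:
  assumes M: "\<And>i. M i > 0"
  shows "roa_estimation {x. evolving_traj f \<Omega> h M x} {x. V 0 x \<le> s}"
  unfolding roa_estimation_def
proof (intro ballI conjI impI)
  fix x0 assume x0: "x0 \<in> {x. V 0 x \<le> s}"
  \<comment> \<open>Off \<Omega> this recursion would use arbitrary values of \<open>h\<close>;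
    membership in \<Omega> is proved afterwards.\<close>
  define x where "x = rec_nat x0 (\<lambda>k y. f y (h (policy_index M k) y))"
  have x: "x 0 = x0" "x (Suc k) = f (x k) (h (policy_index M k) (x k))" for k
    by (simp_all add: x_def)
  have "x k \<in> \<Omega>" for k
    using x0 x by (intro evolving_in_\<Omega>_and_tendsto[where M = M, OF M]) auto
  then show "\<exists>x\<in>{x. evolving_traj f \<Omega> h M x}. x 0 = x0"
    using x by (auto simp: evolving_traj_iff[where M = M, OF M])
next
  fix x0 x assume "x0 \<in> {x. V 0 x \<le> s}" "x \<in> {x. evolving_traj f \<Omega> h M x}" "x 0 = x0"
  then show "x \<longlonglongrightarrow> 0"
    by (intro evolving_in_\<Omega>_and_tendsto[where M = M, OF M]) (auto simp: evolving_traj_iff[where M = M, OF M])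
qed

end

section \<open>From value functions to the real-valued setting\<close>

theorem theorem4:
  fixes f :: "real^'n \<Rightarrow> real^'m \<Rightarrow> real^'n"
    and Q :: "real^'n \<Rightarrow> real" and R :: "real^'m \<Rightarrow> real"
    and U :: "real^'n \<Rightarrow> real^'m \<Rightarrow> real"
    and \<Omega> :: "(real^'n) set"
    and hinit hstar :: "real^'n \<Rightarrow> real^'m"
    and Vhat :: "nat \<Rightarrow> real^'n \<Rightarrow> real"
    and hhat :: "nat \<Rightarrow> real^'n \<Rightarrow> real^'m"
    and \<epsilon> :: "int \<Rightarrow> real^'n \<Rightarrow> real"
    and V0 Vstar :: "real^'n \<Rightarrow> ennreal"
    and Bhat :: "nat \<Rightarrow> real \<Rightarrow> (real^'n) set"
    and Bstar :: "real \<Rightarrow> (real^'n) set"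
    and M :: "nat \<Rightarrow> nat"
    and c \<gamma> r :: real
  defines "U \<equiv> utility Q R"
    and "V0 \<equiv> value_function f U hinit"
    and "Vstar \<equiv> value_function f U hstar"
    and "Bhat \<equiv> (\<lambda>i s. {x. Vhat i x \<le> s})"
    and "Bstar \<equiv> (\<lambda>s. {x. Vstar x \<le> ennreal s})"
  assumes "continuous_on UNIV (\<lambda>(x, u). f x u)" and "f 0 0 = 0"
    and "continuous_on UNIV Q" and "positive_definite Q"
    and "continuous_on UNIV R" and "positive_definite R"
    and "compact \<Omega>" and "connected \<Omega>" and "0 \<in> \<Omega>"
    and "admissible f U \<Omega> hinit"
    and "optimal_policy f U hstar"
    and "approximate_value_iteration f U \<Omega> hinit Vhat hhat \<epsilon>"
    and "0 \<le> c" and "c < 1"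
    and "\<And>i x. i \<ge> -1 \<Longrightarrow> x \<in> \<Omega> \<Longrightarrow> \<bar>\<epsilon> i x\<bar> \<le> c * U x 0"
    and "\<gamma> \<ge> 0" and "\<And>x. x \<in> \<Omega> \<Longrightarrow> V0 x \<le> ennreal (\<gamma> * U x 0)"
    and "c < 1 + 4 * \<gamma> - sqrt (16 * \<gamma>\<^sup>2 + 8 * \<gamma>)"
    and "\<And>i. M i > 0"
    and "r > 0" and "Bstar r \<subseteq> \<Omega>"
    \<comment> \<open>The approximator is constructed on \<open>\<Omega>\<close> only; off \<open>\<Omega>\<close> its values lie above the level used.\<close>
    and "\<And>i x. x \<notin> \<Omega> \<Longrightarrow> Vhat i x > (1 - c) * r"
  shows "compact (Bhat 0 ((1 - c) * r)) \<and>
         roa_estimation {x. evolving_traj f \<Omega> hhat M x} (Bhat 0 ((1 - c) * r))"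
proof -
  have U_0: "U x 0 = Q x" for x
    using assms(11) by (simp add: U_def utility_def positive_definite_def)
  have Q_nonneg: "0 \<le> Q x" for x
    using assms(9) by (cases "x = 0") (auto simp: positive_definite_def less_imp_le)
  have R_nonneg: "0 \<le> R u" for u
    using assms(11) by (cases "u = 0") (auto simp: positive_definite_def less_imp_le)
  have U_nonneg: "0 \<le> U x u" for x u
    using Q_nonneg R_nonneg by (simp add: U_def utility_def)
  have V0_le: "value_function f U hinit x \<le> ennreal (\<gamma> * Q x)" if "x \<in> \<Omega>" for x
    using assms(22)[OF that] by (simp add: V0_def U_0)
  \<comment> \<open>Squaring and cancelling \<open>16 * \<gamma>\<^sup>2 + 8 * \<gamma>\<close>
    leaves \<open>c_small\<close>.\<close>
  have "sqrt (16 * \<gamma>\<^sup>2 + 8 * \<gamma>) < 1 + 4 * \<gamma> - c" using assms(23) by simp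
  then have "(sqrt (16 * \<gamma>\<^sup>2 + 8 * \<gamma>))\<^sup>2 < (1 + 4 * \<gamma> - c)\<^sup>2"
    using assms(21) by (intro power_strict_mono) auto
  then have "16 * \<gamma>\<^sup>2 + 8 * \<gamma> < (1 + 4 * \<gamma> - c)\<^sup>2"
    using assms(21) by simp
  then have c_small: "8 * \<gamma> * c < (1 - c)\<^sup>2"
    by (simp add: power2_eq_square algebra_simps)
  interpret approximate_vi f Q R \<Omega> hinit Vhat hhat \<epsilon> c \<gamma> "(1 - c) * r"
  proof
    show "continuous_on \<Omega> Q" using assms(8) by (rule continuous_on_subset) simp
    show "approximate_value_iteration f (utility Q R) \<Omega> hinit Vhat hhat \<epsilon>"
      using assms(17) by (simp add: U_def)
    show "\<bar>\<epsilon> i x\<bar> \<le> c * Q x" if "i \<ge> -1" "x \<in> \<Omega>" for i x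
      using assms(20)[OF that] by (simp add: U_0)
    show "(\<Sum>k<N. utility Q R (policy_traj f hinit x k) (hinit (policy_traj f hinit x k))) \<le> \<gamma> * Q x"
      if "x \<in> \<Omega>" for x N
      unfolding U_def[symmetric]
      using U_nonneg V0_le[OF that] assms(21) Q_nonneg[of x]
      by (intro partial_cost_le_value_function) auto
    show "(1 - c) * r \<le> (1 - c) * (\<gamma> * Q x)"
      if "x \<in> \<Omega>" and "policy_traj f hinit x k \<notin> \<Omega>" for x k
    proof -
      let ?y = "policy_traj f hinit x k"
      \<comment> \<open>A state off \<Omega> has optimal cost above \<open>r\<close>, and the
        initial policy pays at least this much from there on, as part of its cost from
        \<open>x\<close>.\<close>
      have "ennreal r < Vstar ?y"
        using that(2) assms(26) by (fastforce simp: Bstar_def simp flip: not_le)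
      also have "\<dots> \<le> value_function f U hinit ?y"
        unfolding Vstar_def by (rule optimal_policy_le[OF assms(16)])
      also have "\<dots> \<le> value_function f U hinit x" by (rule value_function_policy_traj_le)
      also note V0_le[OF that(1)]
      finally have "r < \<gamma> * Q x" using assms(25) by (simp add: ennreal_less_iff)
      then show ?thesis using assms(19) by (intro mult_left_mono) auto
    qed
    show "0 < (1 - c) * r" using assms(19,25) by simp
  qed (use assms(9,12,14,18,19,21,27) R_nonneg c_small in auto)
  show ?thesis
    unfolding Bhat_def using compact_sublevel roa_estimation_sublevel[where M = M, OF assms(24)] by blast
qed

end
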